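(* Let $G_1$ and $G_2$ be finitely generated commensurable groups. If $G_1$ is strongly periodic, then $G_2$ is strongly periodic.
   Context: Let $G$ be a group and $A$ a finite discrete set (an alphabet). The full shift $A^G$ is the set of all functions $G\to A$ (called configurations), with the product topology and the left $G$-action $(gx)(h)=x(g^{-1}h)$. A pattern is a function $p:\Omega\to A$ with $\Omega\subset G$ finite; it appears in $x\in A^G$ if $(gx)|_\Omega=p$ for some $g\in G$. A shift of finite type (SFT) over $G$ is a nonempty set of the form $S=\{x\in A^G:\text{ no } p\in P \text{ appears in } x\}$ for some finite alphabet $A$ and some finite set $P$ of patterns (SFTs are nonempty by convention). For $x\in A^G$ let $\mathrm{Stab}_G(x)=\{g\in G: gx=x\}$. A configuration $x$ is strongly periodic if $\mathrm{Stab}_G(x)$ has finite index in $G$. The group $G$ is strongly periodic if every SFT over $G$ (for every finite alphabet) contains a strongly periodic configuration. Two groups $G_1,G_2$ are commensurable if there is a group $H$ such that each of $G_1$ and $G_2$ has a finite index subgroup isomorphic to $H$. *)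

theory Defs
  imports "HOL-Algebra.Algebra"
begin

definition finitely_generated_group :: "('g, 'm) monoid_scheme \<Rightarrow> bool" where
  "finitely_generated_group G \<longleftrightarrow>
     group G \<and> (\<exists>Y. finite Y \<and> Y \<subseteq> carrier G \<and> generate G Y = carrier G)"

definition finite_index :: "('g, 'm) monoid_scheme \<Rightarrow> 'g set \<Rightarrow> bool" where
  "finite_index G H \<longleftrightarrow> finite (rcosets\<^bsub>G\<^esub> H)"

definition has_finite_index_copy :: "('g, 'm) monoid_scheme \<Rightarrow> ('h, 'n) monoid_scheme \<Rightarrow> bool" where
  "has_finite_index_copy G H \<longleftrightarrow>
     (\<exists>K. subgroup K G \<and> finite_index G K \<and> G\<lparr>carrier := K\<rparr> \<cong> H)"

text \<open>
  A quantifier cannot range over types, so the common group is sought on the type of the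
  elements of the first group. This is no restriction, since the common group is isomorphic
  to a subgroup of the first one: see \<open>commensurableI\<close> below.
\<close>

definition commensurable :: "('g, 'm) monoid_scheme \<Rightarrow> ('h, 'n) monoid_scheme \<Rightarrow> bool" where
  "commensurable G1 G2 \<longleftrightarrow>
     (\<exists>H :: 'g monoid. group H \<and> has_finite_index_copy G1 H \<and> has_finite_index_copy G2 H)"

lemma commensurableI:
  fixes H :: "('k, 'l) monoid_scheme"
  assumes "group G1" "group G2" "group H"
    and "has_finite_index_copy G1 H" "has_finite_index_copy G2 H"
  shows "commensurable G1 G2"
proof -
  obtain K1 where K1: "subgroup K1 G1" "finite_index G1 K1" "G1\<lparr>carrier := K1\<rparr> \<cong> H"
    using assms(4) by (auto simp: has_finite_index_copy_def)
  obtain K2 where K2: "subgroup K2 G2" "finite_index G2 K2" "G2\<lparr>carrier := K2\<rparr> \<cong> H"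
    using assms(5) by (auto simp: has_finite_index_copy_def)
  define H' where "H' = \<lparr>carrier = K1, monoid.mult = monoid.mult G1, one = one G1\<rparr>"
  have g: "group (G1\<lparr>carrier := K1\<rparr>)"
    using K1(1) assms(1) by (rule subgroup.subgroup_is_group)
  have g': "group H'"
    using g unfolding H'_def group_def group_axioms_def monoid_def Units_def by simp
  have i: "G1\<lparr>carrier := K1\<rparr> \<cong> H'"
    unfolding is_iso_def iso_def hom_def H'_def
    by (auto intro!: exI[of _ "\<lambda>x. x"] simp: bij_betw_def subgroup.m_closed[OF K1(1)])
  have "G2\<lparr>carrier := K2\<rparr> \<cong> H'"
    using K2(3) group.iso_sym[OF g K1(3)] i by (meson iso_trans)
  with i g' K1 K2 show ?thesis
    unfolding commensurable_def has_finite_index_copy_def by blast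
qed

text \<open>
  Configurations are extensional functions on the carrier, so that equality of configurations
  is pointwise equality on the group.
\<close>

definition full_shift :: "('g, 'm) monoid_scheme \<Rightarrow> 'a set \<Rightarrow> ('g \<Rightarrow> 'a) set" where
  "full_shift G A = (carrier G \<rightarrow>\<^sub>E A)"

definition shift_action :: "('g, 'm) monoid_scheme \<Rightarrow> 'g \<Rightarrow> ('g \<Rightarrow> 'a) \<Rightarrow> 'g \<Rightarrow> 'a" where
  "shift_action G g x = (\<lambda>h\<in>carrier G. x (inv\<^bsub>G\<^esub> g \<otimes>\<^bsub>G\<^esub> h))"

text \<open>A pattern is a pair of its finite support and an extensional function on it.\<close>

definition patterns :: "('g, 'm) monoid_scheme \<Rightarrow> 'a set \<Rightarrow> ('g set \<times> ('g \<Rightarrow> 'a)) set" where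
  "patterns G A = {(W, p). finite W \<and> W \<subseteq> carrier G \<and> p \<in> W \<rightarrow>\<^sub>E A}"

definition appears_in ::
    "('g, 'm) monoid_scheme \<Rightarrow> 'g set \<times> ('g \<Rightarrow> 'a) \<Rightarrow> ('g \<Rightarrow> 'a) \<Rightarrow> bool" where
  "appears_in G q x \<longleftrightarrow> (\<exists>g\<in>carrier G. restrict (shift_action G g x) (fst q) = snd q)"

definition is_SFT :: "('g, 'm) monoid_scheme \<Rightarrow> 'a set \<Rightarrow> ('g \<Rightarrow> 'a) set \<Rightarrow> bool" where
  "is_SFT G A S \<longleftrightarrow>
     finite A \<and> S \<noteq> {} \<and>
     (\<exists>P. finite P \<and> P \<subseteq> patterns G A \<and>
          S = {x \<in> full_shift G A. \<forall>q\<in>P. \<not> appears_in G q x})"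

definition strongly_periodic_config :: "('g, 'm) monoid_scheme \<Rightarrow> ('g \<Rightarrow> 'a) \<Rightarrow> bool" where
  "strongly_periodic_config G x \<longleftrightarrow> finite_index G (stabilizer G (shift_action G) x)"

text \<open>
  Alphabets range over the finite sets of natural numbers, which represent all finite sets up
  to bijection; \<open>strongly_periodic_groupD\<close> gives the property for alphabets of any type.
\<close>

definition strongly_periodic_group :: "('g, 'm) monoid_scheme \<Rightarrow> bool" where
  "strongly_periodic_group G \<longleftrightarrow>
     (\<forall>(A :: nat set) S. is_SFT G A S \<longrightarrow> (\<exists>x\<in>S. strongly_periodic_config G x))"

lemma strongly_periodic_groupD:
  fixes G :: "('g, 'm) monoid_scheme" and A :: "'a set"
  assumes G: "group G" and per: "strongly_periodic_group G" and S: "is_SFT G A S"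
  shows "\<exists>x\<in>S. strongly_periodic_config G x"
proof -
  interpret group G by (rule G)
  obtain P where A: "finite A" and ne: "S \<noteq> {}" and P: "finite P" "P \<subseteq> patterns G A"
    and S_eq: "S = {x \<in> full_shift G A. \<forall>q\<in>P. \<not> appears_in G q x}"
    using S by (auto simp: is_SFT_def)
  obtain f :: "'a \<Rightarrow> nat" where f: "inj_on f A"
    using finite_imp_inj_to_nat_seg[OF A] by auto
  define r where "r W x = (\<lambda>h\<in>W. f (x h))" for W :: "'g set" and x
  define F where "F = r (carrier G)"
  define T where "T q = (fst q, r (fst q) (snd q))" for q
  have r_inj: "x = y" if "x \<in> W \<rightarrow>\<^sub>E A" "y \<in> W \<rightarrow>\<^sub>E A" "r W x = r W y" for W x y
  proof (rule PiE_ext[OF that(1,2)])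
    fix h assume "h \<in> W"
    with that show "x h = y h"
      by (metis PiE_mem f inj_onD r_def restrict_apply')
  qed
  have r_surj: "\<exists>x \<in> W \<rightarrow>\<^sub>E A. r W x = y" if y: "y \<in> W \<rightarrow>\<^sub>E f ` A" for W y
  proof
    let ?x = "\<lambda>h\<in>W. inv_into A f (y h)"
    have h: "y h \<in> f ` A" if "h \<in> W" for h
      using y that by (rule PiE_mem)
    show "?x \<in> W \<rightarrow>\<^sub>E A"
      using inv_into_into[OF h] by simp
    have "r W ?x = restrict y W"
      unfolding r_def using f_inv_into_f[OF h] by (intro restrict_ext) simp
    then show "r W ?x = y"
      using PiE_restrict[OF y] by simp
  qed
  have F_shift: "F x \<in> full_shift G (f ` A)" if "x \<in> full_shift G A" for x
    using that by (auto simp: F_def r_def full_shift_def)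
  have act_shift: "shift_action G g x \<in> full_shift G A"
    if "x \<in> full_shift G A" "g \<in> carrier G" for g and x :: "'g \<Rightarrow> 'a"
    using that by (auto simp: shift_action_def full_shift_def)
  have act_F: "shift_action G g (F x) = F (shift_action G g x)" if "g \<in> carrier G" for g x
    using that by (auto simp: F_def r_def shift_action_def)
  have app: "appears_in G (T q) (F x) \<longleftrightarrow> appears_in G q x"
    if "x \<in> full_shift G A" "q \<in> patterns G A" for x q
  proof -
    have W: "fst q \<subseteq> carrier G" and p: "snd q \<in> fst q \<rightarrow>\<^sub>E A"
      using that(2) by (auto simp: patterns_def)
    have "restrict (shift_action G g (F x)) (fst q) = r (fst q) (snd q) \<longleftrightarrow>
          restrict (shift_action G g x) (fst q) = snd q" if g: "g \<in> carrier G" for g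
    proof -
      have "restrict (shift_action G g (F x)) (fst q)
          = r (fst q) (restrict (shift_action G g x) (fst q))"
        unfolding act_F[OF g] using W by (auto simp: F_def r_def fun_eq_iff)
      moreover have "restrict (shift_action G g x) (fst q) \<in> fst q \<rightarrow>\<^sub>E A"
        using act_shift[OF \<open>x \<in> full_shift G A\<close> g] W by (auto simp: full_shift_def)
      ultimately show ?thesis
        using r_inj p by metis
    qed
    then show ?thesis
      by (simp add: appears_in_def T_def)
  qed
  define S' where "S' = {y \<in> full_shift G (f ` A). \<forall>q\<in>T ` P. \<not> appears_in G q y}"
  have S'_iff: "F x \<in> S' \<longleftrightarrow> x \<in> S" if "x \<in> full_shift G A" for x
  proof -
    have "appears_in G (T q) (F x) \<longleftrightarrow> appears_in G q x" if "q \<in> P" for q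
      using app \<open>x \<in> full_shift G A\<close> P(2) that by blast
    then show ?thesis
      using that F_shift by (simp add: S'_def S_eq)
  qed
  have "T q \<in> patterns G (f ` A)" if "q \<in> patterns G A" for q
    using that by (auto simp: patterns_def T_def r_def dest: PiE_mem)
  then have "T ` P \<subseteq> patterns G (f ` A)"
    using P(2) by blast
  moreover have "S' \<noteq> {}"
    using ne S'_iff by (auto simp: S_eq)
  ultimately have "is_SFT G (f ` A) S'"
    unfolding is_SFT_def using A P(1) by (auto simp: S'_def intro!: exI[of _ "T ` P"])
  then obtain y where y: "y \<in> S'" "strongly_periodic_config G y"
    using per by (auto simp: strongly_periodic_group_def)
  then obtain x where x: "x \<in> full_shift G A" "F x = y"
    using r_surj[of y "carrier G"] by (auto simp: S'_def full_shift_def F_def)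
  have "shift_action G g y = y \<longleftrightarrow> shift_action G g x = x" if g: "g \<in> carrier G" for g
    using r_inj[of "shift_action G g x" "carrier G" x] act_shift[OF x(1) g] x(1) act_F[OF g, of x]
    unfolding x(2)[symmetric] full_shift_def F_def by metis
  then have "stabilizer G (shift_action G) y = stabilizer G (shift_action G) x"
    by (auto simp: stabilizer_def)
  then have "strongly_periodic_config G x"
    using y(2) by (simp add: strongly_periodic_config_def)
  with x y(1) S'_iff show ?thesis
    by blast
qed

end

theory Submission
  imports Defs
begin

text \<open>
  Strong periodicity passes from a group \<open>G\<close> to every group \<open>H\<close> embedded in \<open>G\<close>: impose the local
  rule of an SFT over \<open>H\<close> at every element of \<open>G\<close>. Copying a configuration over \<open>H\<close> to every left
  coset of \<open>H\<close> shows that the resulting SFT over \<open>G\<close> is nonempty, and the restriction to \<open>H\<close> of a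
  strongly periodic configuration over \<open>G\<close> is strongly periodic. Conversely, if \<open>H\<close> has finite
  index in \<open>G\<close> and \<open>T\<close> is a set of representatives of its right cosets, then \<open>A\<^sup>G\<close> is identified
  \<open>H\<close>-equivariantly with the full shift over \<open>H\<close> with alphabet \<open>A\<^sup>T\<close>, an SFT over \<open>G\<close> becomes an
  SFT over \<open>H\<close>, and a finite index subgroup of \<open>H\<close> has finite index in \<open>G\<close>.
\<close>

section \<open>Finite index subgroups and coset representatives\<close>

lemma (in group) finite_indexI:
  assumes K: "subgroup K G" and fin: "finite (c ` carrier G)"
    and c: "\<And>g g'. \<lbrakk>g \<in> carrier G; g' \<in> carrier G; c g = c g'\<rbrakk> \<Longrightarrow> g \<otimes> inv g' \<in> K"
  shows "finite_index G K"
proof -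
  \<comment> \<open>\<open>d\<close> picks one preimage of each value of \<open>c\<close>. By the
    hypothesis on \<open>c\<close>, that preimage lies in the same coset as every other element with
    this value, so the cosets are parametrised by the finite set of values.\<close>
  define d where "d v = K #> inv_into (carrier G) c v" for v
  have "K #> g = d (c g)" if g: "g \<in> carrier G" for g
  proof -
    let ?g' = "inv_into (carrier G) c (c g)"
    have g': "?g' \<in> carrier G" "c ?g' = c g"
      using g by (auto intro: inv_into_into f_inv_into_f)
    have "g \<otimes> inv ?g' \<in> K"
      using c[OF g g'(1)] g'(2) by simp
    then have "K #> (g \<otimes> inv ?g') = K"
      using K by (simp add: coset_join2 subgroup.mem_carrier)
    then show ?thesis
      unfolding d_def
      by (metis K g g'(1) coset_mult_inv1 subgroup.subset)
  qed
  then have "rcosets K \<subseteq> d ` c ` carrier G"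
    by (auto simp: RCOSETS_def)
  then show ?thesis
    unfolding finite_index_def using fin by (meson finite_imageI finite_subset)
qed

lemma (in group) rcos_eq_imp_div_mem:
  assumes K: "subgroup K G" and g: "g \<in> carrier G" "g' \<in> carrier G" and eq: "K #> g = K #> g'"
  shows "g \<otimes> inv g' \<in> K"
proof -
  have "g \<in> K #> g'"
    using rcos_self[OF g(1) K] eq by simp
  then show ?thesis
    using K g by (auto simp: r_coset_def inv_solve_right' m_assoc subgroup.mem_carrier)
qed

lemma finite_rcos_image: "finite_index G K \<Longrightarrow> finite ((\<lambda>g. K #>\<^bsub>G\<^esub> g) ` carrier G)"
  unfolding finite_index_def by (erule rev_finite_subset) (auto simp: RCOSETS_def)

text \<open>The representative is chosen from the coset as a set, so \<open>\<tau>\<close> is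
  constant on each right coset and has at most one value per coset. It serves to split every element
  into a part in \<open>H\<close> and a representative.\<close>

lemma (in group) transversal:
  assumes H: "subgroup H G"
  obtains \<tau> where "\<tau> \<in> carrier G \<rightarrow> carrier G"
    and "\<And>g. g \<in> carrier G \<Longrightarrow> g \<otimes> inv \<tau> g \<in> H"
    and "\<And>h g. \<lbrakk>h \<in> H; g \<in> carrier G\<rbrakk> \<Longrightarrow> \<tau> (h \<otimes> g) = \<tau> g"
    and "finite_index G H \<Longrightarrow> finite (\<tau> ` carrier G)"
proof -
  define \<tau> where "\<tau> g = (SOME k. k \<in> H #> g)" for g
  have mem: "\<tau> g \<in> H #> g" if "g \<in> carrier G" for g
    unfolding \<tau>_def using rcos_self[OF that H] by (rule someI)
  have carr: "\<tau> g \<in> carrier G" if "g \<in> carrier G" for g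
    using mem[OF that] r_coset_subset_G[OF subgroup.subset[OF H] that] by blast
  show thesis
  proof
    show "\<tau> \<in> carrier G \<rightarrow> carrier G"
      using carr by simp
    show "g \<otimes> inv \<tau> g \<in> H" if "g \<in> carrier G" for g
      using rcos_eq_imp_div_mem[OF H that carr[OF that]] repr_independence[OF mem[OF that] that H]
      by simp
    show "\<tau> (h \<otimes> g) = \<tau> g" if "h \<in> H" "g \<in> carrier G" for h g
    proof -
      have "H #> (h \<otimes> g) = H #> g"
        using H that by (metis coset_join2 coset_mult_assoc subgroup.mem_carrier subgroup.subset)
      then show ?thesis
        by (simp add: \<tau>_def)
    qed
    assume "finite_index G H"
    then have "finite ((\<lambda>C. SOME k. k \<in> C) ` (\<lambda>g. H #> g) ` carrier G)"
      by (intro finite_imageI finite_rcos_image)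
    then show "finite (\<tau> ` carrier G)"
      by (simp add: image_image \<tau>_def)
  qed
qed

text \<open>Classify \<open>h\<close> by the coset of \<open>\<phi> h\<close>: two elements in the
  same class differ by an element of the preimage of \<open>K\<close>. \<open>L\<close> may exceed
  that preimage because restricting a configuration can create new periods.\<close>

lemma finite_index_preimage:
  assumes "group G" "group H" "\<phi> \<in> hom H G"
    and K: "subgroup K G" "finite_index G K"
    and L: "subgroup L H" "{h \<in> carrier H. \<phi> h \<in> K} \<subseteq> L"
  shows "finite_index H L"
proof -
  interpret group_hom H G \<phi>
    using assms by (simp add: group_hom_def group_hom_axioms_def)
  show ?thesis
  proof (rule G.finite_indexI[OF L(1)])
    show "finite ((\<lambda>h. K #>\<^bsub>G\<^esub> \<phi> h) ` carrier H)"
      by (rule finite_subset[OF _ finite_rcos_image[OF K(2)]]) auto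
    fix g g' assume g: "g \<in> carrier H" "g' \<in> carrier H" "K #>\<^bsub>G\<^esub> \<phi> g = K #>\<^bsub>G\<^esub> \<phi> g'"
    then have "\<phi> g \<otimes>\<^bsub>G\<^esub> inv\<^bsub>G\<^esub> \<phi> g' \<in> K"
      using group.rcos_eq_imp_div_mem[OF assms(1) K(1)] by simp
    then show "g \<otimes>\<^bsub>H\<^esub> inv\<^bsub>H\<^esub> g' \<in> L"
      using g L(2) by auto
  qed
qed

text \<open>Classify \<open>g\<close> by its representative modulo \<open>H\<close> together with
  the \<open>K\<close>-coset of its part in \<open>H\<close>. Both range over finite sets, and when
  they agree for \<open>g\<close> and \<open>g'\<close> the common representative cancels from the
  quotient.\<close>

lemma (in group) finite_index_trans:
  assumes H: "subgroup H G" "finite_index G H"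
    and K: "subgroup K (G\<lparr>carrier := H\<rparr>)" "finite_index (G\<lparr>carrier := H\<rparr>) K"
    and L: "subgroup L G" "K \<subseteq> L"
  shows "finite_index G L"
proof -
  obtain \<tau> where \<tau>: "\<tau> \<in> carrier G \<rightarrow> carrier G" "\<And>g. g \<in> carrier G \<Longrightarrow> g \<otimes> inv \<tau> g \<in> H"
      "finite (\<tau> ` carrier G)"
    using transversal[OF H(1)] H(2) by metis
  define c where "c g = (\<tau> g, K #>\<^bsub>G\<lparr>carrier := H\<rparr>\<^esub> (g \<otimes> inv \<tau> g))" for g
  show ?thesis
  proof (rule finite_indexI[OF L(1)])
    have "c ` carrier G \<subseteq> \<tau> ` carrier G \<times> (\<lambda>h. K #>\<^bsub>G\<lparr>carrier := H\<rparr>\<^esub> h) ` H"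
      using \<tau>(2) by (auto simp: c_def)
    then show "finite (c ` carrier G)"
      using \<tau>(3) finite_rcos_image[OF K(2)] by (auto intro: finite_subset)
    fix g g' assume g: "g \<in> carrier G" "g' \<in> carrier G" and "c g = c g'"
    then have eq: "\<tau> g = \<tau> g'" and
      cos: "K #>\<^bsub>G\<lparr>carrier := H\<rparr>\<^esub> (g \<otimes> inv \<tau> g) = K #>\<^bsub>G\<lparr>carrier := H\<rparr>\<^esub> (g' \<otimes> inv \<tau> g')"
      unfolding c_def prod.inject by blast+
    have t: "\<tau> g' \<in> carrier G"
      using \<tau>(1) g by auto
    have mem: "(g \<otimes> inv \<tau> g) \<otimes> inv (g' \<otimes> inv \<tau> g') \<in> K"
      using group.rcos_eq_imp_div_mem[OF subgroup.subgroup_is_group[OF H(1) is_group] K(1) _ _ cos]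
        \<tau>(2) g H(1) by (simp add: m_inv_consistent)
    have "inv \<tau> g' \<otimes> (\<tau> g' \<otimes> inv g') = inv g'"
      using g t by (simp add: m_assoc[symmetric])
    then have "(g \<otimes> inv \<tau> g) \<otimes> inv (g' \<otimes> inv \<tau> g') = g \<otimes> inv g'"
      using g t unfolding eq by (simp add: inv_mult_group m_assoc)
    then show "g \<otimes> inv g' \<in> L"
      using mem L(2) by auto
  qed
qed

section \<open>Periods of configurations and local rules of SFTs\<close>

lemma (in group) stabilizer_shift_eq:
  assumes "x \<in> full_shift G A"
  shows "stabilizer G (shift_action G) x = {g \<in> carrier G. \<forall>h\<in>carrier G. x (g \<otimes> h) = x h}"
proof -
  have "shift_action G g x = x \<longleftrightarrow> (\<forall>h\<in>carrier G. x (g \<otimes> h) = x h)" if g: "g \<in> carrier G" for g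
  proof
    assume "shift_action G g x = x"
    then have "x (inv g \<otimes> h) = x h" if "h \<in> carrier G" for h
      using that by (metis restrict_apply' shift_action_def)
    \<comment> \<open>Applying this to \<open>g \<otimes> h\<close> in place of \<open>h\<close>
      removes the inverse.\<close>
    then show "\<forall>h\<in>carrier G. x (g \<otimes> h) = x h"
      using g by (metis inv_closed inv_solve_left m_closed)
  next
    assume *: "\<forall>h\<in>carrier G. x (g \<otimes> h) = x h"
    have "x (inv g \<otimes> h) = x h" if "h \<in> carrier G" for h
      using *[rule_format, of "inv g \<otimes> h"] g that by (simp add: m_assoc[symmetric])
    then have "shift_action G g x = restrict x (carrier G)"
      by (auto simp: shift_action_def intro: restrict_ext)
    then show "shift_action G g x = x"
      using assms PiE_restrict unfolding full_shift_def by metis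
  qed
  then show ?thesis
    by (auto simp: stabilizer_def)
qed

lemma (in group) stabilizer_shift_subgroup:
  assumes "x \<in> full_shift G A"
  shows "subgroup (stabilizer G (shift_action G) x) G"
  unfolding stabilizer_shift_eq[OF assms]
proof (rule subgroupI)
  fix g assume "g \<in> {g \<in> carrier G. \<forall>h\<in>carrier G. x (g \<otimes> h) = x h}"
  then have g: "g \<in> carrier G" and *: "\<forall>h\<in>carrier G. x (g \<otimes> h) = x h"
    by auto
  have "x (inv g \<otimes> h) = x h" if "h \<in> carrier G" for h
    using *[rule_format, of "inv g \<otimes> h"] g that by (simp add: m_assoc[symmetric])
  then show "inv g \<in> {g \<in> carrier G. \<forall>h\<in>carrier G. x (g \<otimes> h) = x h}"
    using g by simp
next
  have "\<one> \<in> {g \<in> carrier G. \<forall>h\<in>carrier G. x (g \<otimes> h) = x h}"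
    by simp
  then show "{g \<in> carrier G. \<forall>h\<in>carrier G. x (g \<otimes> h) = x h} \<noteq> {}"
    by blast
qed (auto simp: m_assoc)

text \<open>A single finite window with its set of allowed contents replaces a family of forbidden
  patterns with varying supports. The window is read at \<open>g \<otimes> w\<close>, without the
  inverse of the shift action. \<open>L\<close> may contain functions that are not patterns on
  \<open>W\<close>, which makes it easy to transport along maps.\<close>

definition local_rule_shift ::
    "('g, 'm) monoid_scheme \<Rightarrow> 'a set \<Rightarrow> 'g set \<Rightarrow> ('g \<Rightarrow> 'a) set \<Rightarrow> ('g \<Rightarrow> 'a) set" where
  "local_rule_shift G A W L =
     {x \<in> full_shift G A. \<forall>g\<in>carrier G. (\<lambda>w\<in>W. x (g \<otimes>\<^bsub>G\<^esub> w)) \<in> L}"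

lemma (in group) appears_in_iff:
  assumes "fst q \<subseteq> carrier G"
  shows "appears_in G q x \<longleftrightarrow> (\<exists>g\<in>carrier G. (\<lambda>w\<in>fst q. x (g \<otimes> w)) = snd q)"
proof -
  have "restrict (shift_action G g x) (fst q) = (\<lambda>w\<in>fst q. x (inv g \<otimes> w))" for g
    using assms by (auto simp: shift_action_def fun_eq_iff)
  then show ?thesis
    unfolding appears_in_def by (metis inv_closed inv_inv)
qed

lemma (in group) is_SFT_local_rule_shift:
  assumes A: "finite A" and W: "finite W" "W \<subseteq> carrier G" and ne: "local_rule_shift G A W L \<noteq> {}"
  shows "is_SFT G A (local_rule_shift G A W L)"
proof -
  \<comment> \<open>Forbid every pattern on the window that is not allowed. There are finitely many
    even if \<open>L\<close> is infinite.\<close>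
  define P where "P = Pair W ` ((W \<rightarrow>\<^sub>E A) - L)"
  have "finite P"
    unfolding P_def using A W(1) by (simp add: finite_PiE)
  moreover have "P \<subseteq> patterns G A"
    using W by (auto simp: P_def patterns_def)
  moreover have "(\<forall>q\<in>P. \<not> appears_in G q x) \<longleftrightarrow> (\<forall>g\<in>carrier G. (\<lambda>w\<in>W. x (g \<otimes> w)) \<in> L)"
    if "x \<in> full_shift G A" for x
  proof -
    define r where "r g = (\<lambda>w\<in>W. x (g \<otimes> w))" for g
    have r: "r g \<in> W \<rightarrow>\<^sub>E A" if "g \<in> carrier G" for g
      using \<open>x \<in> full_shift G A\<close> that W(2) by (auto simp: full_shift_def r_def)
    have "appears_in G (W, p) x \<longleftrightarrow> (\<exists>g\<in>carrier G. r g = p)" for p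
      using appears_in_iff[of "(W, p)" x] W(2) by (simp add: r_def)
    then have "(\<forall>q\<in>P. \<not> appears_in G q x) \<longleftrightarrow> (\<forall>p\<in>(W \<rightarrow>\<^sub>E A) - L. \<forall>g\<in>carrier G. r g \<noteq> p)"
      by (simp add: P_def)
    also have "\<dots> \<longleftrightarrow> (\<forall>g\<in>carrier G. r g \<in> L)"
      using r by blast
    finally show ?thesis
      by (simp add: r_def)
  qed
  ultimately show ?thesis
    unfolding is_SFT_def using A ne by (auto simp: local_rule_shift_def intro!: exI[of _ P])
qed

lemma (in group) is_SFT_obtain_local_rule:
  assumes "is_SFT G A S"
  obtains W L where "finite A" "finite W" "W \<subseteq> carrier G" "S \<noteq> {}" "S = local_rule_shift G A W L"
proof -
  obtain P where A: "finite A" and ne: "S \<noteq> {}" and P: "finite P" "P \<subseteq> patterns G A"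
    and S: "S = {x \<in> full_shift G A. \<forall>q\<in>P. \<not> appears_in G q x}"
    using assms by (auto simp: is_SFT_def)
  \<comment> \<open>The union of all supports is a common window, and its content is allowed if no
    restriction of it to a support is forbidden.\<close>
  define W where "W = (\<Union>q\<in>P. fst q)"
  define L where "L = {p. \<forall>q\<in>P. restrict p (fst q) \<noteq> snd q}"
  have W: "finite W" "W \<subseteq> carrier G"
    using P by (fastforce simp: W_def patterns_def)+
  have "\<not> appears_in G q x \<longleftrightarrow> (\<forall>g\<in>carrier G. restrict (\<lambda>w\<in>W. x (g \<otimes> w)) (fst q) \<noteq> snd q)"
    if "q \<in> P" for q x
  proof -
    have "fst q \<subseteq> carrier G" "fst q \<subseteq> W"
      using that P(2) by (fastforce simp: patterns_def W_def)+
    then show ?thesis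
      by (simp add: appears_in_iff Int_absorb1)
  qed
  then have "S = local_rule_shift G A W L"
    unfolding S local_rule_shift_def L_def by blast
  then show thesis
    using that A W ne by blast
qed

section \<open>Descent to embedded groups\<close>

lemma strongly_periodic_group_embedding:
  fixes G :: "('g, 'm) monoid_scheme" and H :: "('h, 'n) monoid_scheme"
  assumes G: "group G" and H: "group H" and hom: "\<phi> \<in> hom H G" and inj: "inj_on \<phi> (carrier H)"
    and per: "strongly_periodic_group G"
  shows "strongly_periodic_group H"
  unfolding strongly_periodic_group_def
proof (intro allI impI)
  interpret G: group G by (rule G)
  interpret H: group H by (rule H)
  interpret \<phi>: group_hom H G \<phi>
    using hom by unfold_locales
  fix A :: "nat set" and S
  assume "is_SFT H A S"
  then obtain W L where A: "finite A" and W: "finite W" "W \<subseteq> carrier H" and ne: "S \<noteq> {}"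
    and S: "S = local_rule_shift H A W L"
    by (rule H.is_SFT_obtain_local_rule)
  define L' where "L' = {p. (\<lambda>w\<in>W. p (\<phi> w)) \<in> L}"
  define Z where "Z = local_rule_shift G A (\<phi> ` W) L'"
  have rule_eq: "(\<lambda>v\<in>\<phi> ` W. x (g \<otimes>\<^bsub>G\<^esub> v)) \<in> L' \<longleftrightarrow> (\<lambda>w\<in>W. x (g \<otimes>\<^bsub>G\<^esub> \<phi> w)) \<in> L" for x g
    unfolding L'_def by (simp cong: restrict_cong)

  have "subgroup (\<phi> ` carrier H) G"
    by (rule \<phi>.img_is_subgroup)
  then obtain \<tau> where \<tau>: "\<tau> \<in> carrier G \<rightarrow> carrier G"
      "\<And>g. g \<in> carrier G \<Longrightarrow> g \<otimes>\<^bsub>G\<^esub> inv\<^bsub>G\<^esub> \<tau> g \<in> \<phi> ` carrier H"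
      "\<And>h g. \<lbrakk>h \<in> carrier H; g \<in> carrier G\<rbrakk> \<Longrightarrow> \<tau> (\<phi> h \<otimes>\<^bsub>G\<^esub> g) = \<tau> g"
    using G.transversal by (metis imageI)
  \<comment> \<open>\<open>\<kappa> g\<close> is the position of \<open>g\<close> within its left coset: \<open>g = r \<otimes> \<phi> (\<kappa> g)\<close>, where the
    representative \<open>r = inv \<tau> (inv g)\<close> depends on the coset only.\<close>
  define \<kappa> where "\<kappa> g = inv_into (carrier H) \<phi> (\<tau> (inv\<^bsub>G\<^esub> g) \<otimes>\<^bsub>G\<^esub> g)" for g
  have img: "\<tau> (inv\<^bsub>G\<^esub> g) \<otimes>\<^bsub>G\<^esub> g \<in> \<phi> ` carrier H" if g: "g \<in> carrier G" for g
  proof -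
    have t: "\<tau> (inv\<^bsub>G\<^esub> g) \<in> carrier G"
      using \<tau>(1) g by auto
    obtain h where h: "h \<in> carrier H" "inv\<^bsub>G\<^esub> g \<otimes>\<^bsub>G\<^esub> inv\<^bsub>G\<^esub> \<tau> (inv\<^bsub>G\<^esub> g) = \<phi> h"
      using \<tau>(2)[of "inv\<^bsub>G\<^esub> g"] g by auto
    have "inv\<^bsub>G\<^esub> (inv\<^bsub>G\<^esub> g \<otimes>\<^bsub>G\<^esub> inv\<^bsub>G\<^esub> \<tau> (inv\<^bsub>G\<^esub> g)) = \<tau> (inv\<^bsub>G\<^esub> g) \<otimes>\<^bsub>G\<^esub> g"
      using g t by (simp add: G.inv_mult_group)
    then have "\<tau> (inv\<^bsub>G\<^esub> g) \<otimes>\<^bsub>G\<^esub> g = \<phi> (inv\<^bsub>H\<^esub> h)"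
      using h by simp
    then show ?thesis
      using h(1) by blast
  qed
  have \<kappa>_carr: "\<kappa> g \<in> carrier H" if "g \<in> carrier G" for g
    unfolding \<kappa>_def using img[OF that] by (rule inv_into_into)
  have \<phi>_\<kappa>: "\<phi> (\<kappa> g) = \<tau> (inv\<^bsub>G\<^esub> g) \<otimes>\<^bsub>G\<^esub> g" if "g \<in> carrier G" for g
    unfolding \<kappa>_def using img[OF that] by (rule f_inv_into_f)
  \<comment> \<open>Right multiplication by \<open>\<phi> h\<close> stays in the left coset of
    \<open>g\<close>; after inversion this is the invariance of \<open>\<tau>\<close>. Hence the
    window of the copied configuration at \<open>g\<close> shows what \<open>y\<close> shows at
    \<open>\<kappa> g\<close>.\<close>
  have \<kappa>_mult: "\<kappa> (g \<otimes>\<^bsub>G\<^esub> \<phi> h) = \<kappa> g \<otimes>\<^bsub>H\<^esub> h" if g: "g \<in> carrier G" and h: "h \<in> carrier H" for g h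
  proof (rule inj_onD[OF inj])
    have "\<tau> (inv\<^bsub>G\<^esub> (g \<otimes>\<^bsub>G\<^esub> \<phi> h)) = \<tau> (\<phi> (inv\<^bsub>H\<^esub> h) \<otimes>\<^bsub>G\<^esub> inv\<^bsub>G\<^esub> g)"
      using g h by (simp add: G.inv_mult_group)
    also have "\<dots> = \<tau> (inv\<^bsub>G\<^esub> g)"
      using g h by (intro \<tau>(3)) auto
    finally have "\<tau> (inv\<^bsub>G\<^esub> (g \<otimes>\<^bsub>G\<^esub> \<phi> h)) = \<tau> (inv\<^bsub>G\<^esub> g)" .
    moreover have "\<tau> (inv\<^bsub>G\<^esub> g) \<in> carrier G"
      using \<tau>(1) g by auto
    ultimately show "\<phi> (\<kappa> (g \<otimes>\<^bsub>G\<^esub> \<phi> h)) = \<phi> (\<kappa> g \<otimes>\<^bsub>H\<^esub> h)"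
      using g h \<kappa>_carr[OF g] by (simp add: \<phi>_\<kappa> G.m_assoc)
  qed (use g h \<kappa>_carr in auto)

  obtain y where "y \<in> S"
    using ne by blast
  then have y: "y \<in> full_shift H A" "\<And>h. h \<in> carrier H \<Longrightarrow> (\<lambda>w\<in>W. y (h \<otimes>\<^bsub>H\<^esub> w)) \<in> L"
    by (auto simp: S local_rule_shift_def)
  define x0 where "x0 = (\<lambda>g\<in>carrier G. y (\<kappa> g))"
  have "x0 \<in> full_shift G A"
    using y(1) \<kappa>_carr by (auto simp: x0_def full_shift_def)
  moreover have "(\<lambda>w\<in>W. x0 (g \<otimes>\<^bsub>G\<^esub> \<phi> w)) \<in> L" if g: "g \<in> carrier G" for g
  proof -
    have "(\<lambda>w\<in>W. x0 (g \<otimes>\<^bsub>G\<^esub> \<phi> w)) = (\<lambda>w\<in>W. y (\<kappa> g \<otimes>\<^bsub>H\<^esub> w))"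
      using W(2) g by (intro restrict_ext) (auto simp: x0_def \<kappa>_mult subset_iff)
    then show ?thesis
      using y(2)[OF \<kappa>_carr[OF g]] by simp
  qed
  ultimately have "x0 \<in> Z"
    by (simp add: Z_def local_rule_shift_def rule_eq)
  then have "is_SFT G A Z"
    unfolding Z_def using A W by (intro G.is_SFT_local_rule_shift) auto
  then obtain x where "x \<in> Z" and fin: "finite_index G (stabilizer G (shift_action G) x)"
    using per by (auto simp: strongly_periodic_group_def strongly_periodic_config_def)
  then have x: "x \<in> full_shift G A" "\<And>g. g \<in> carrier G \<Longrightarrow> (\<lambda>w\<in>W. x (g \<otimes>\<^bsub>G\<^esub> \<phi> w)) \<in> L"
    by (auto simp: Z_def local_rule_shift_def rule_eq)

  define z where "z = (\<lambda>h\<in>carrier H. x (\<phi> h))"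
  have z: "z \<in> full_shift H A"
    using x(1) by (auto simp: z_def full_shift_def)
  have "(\<lambda>w\<in>W. z (h \<otimes>\<^bsub>H\<^esub> w)) \<in> L" if h: "h \<in> carrier H" for h
  proof -
    have "(\<lambda>w\<in>W. z (h \<otimes>\<^bsub>H\<^esub> w)) = (\<lambda>w\<in>W. x (\<phi> h \<otimes>\<^bsub>G\<^esub> \<phi> w))"
      using W(2) h by (intro restrict_ext) (auto simp: z_def subset_iff)
    then show ?thesis
      using x(2) h by simp
  qed
  then have "z \<in> S"
    using z by (simp add: S local_rule_shift_def)
  moreover have "finite_index H (stabilizer H (shift_action H) z)"
  proof (rule finite_index_preimage[OF G H hom _ fin])
    show "subgroup (stabilizer G (shift_action G) x) G"
      by (rule G.stabilizer_shift_subgroup[OF x(1)])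
    show "subgroup (stabilizer H (shift_action H) z) H"
      by (rule H.stabilizer_shift_subgroup[OF z])
    show "{h \<in> carrier H. \<phi> h \<in> stabilizer G (shift_action G) x} \<subseteq> stabilizer H (shift_action H) z"
      unfolding G.stabilizer_shift_eq[OF x(1)] H.stabilizer_shift_eq[OF z] by (auto simp: z_def)
  qed
  ultimately show "\<exists>z\<in>S. strongly_periodic_config H z"
    by (auto simp: strongly_periodic_config_def)
qed

section \<open>Ascent to finite extensions\<close>

lemma (in group) strongly_periodic_group_finite_extension:
  assumes H: "subgroup H G" "finite_index G H"
    and per: "strongly_periodic_group (G\<lparr>carrier := H\<rparr>)"
  shows "strongly_periodic_group G"
  unfolding strongly_periodic_group_def
proof (intro allI impI)
  let ?H = "G\<lparr>carrier := H\<rparr>"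
  have grp: "group ?H"
    by (rule subgroup.subgroup_is_group[OF H(1) is_group])
  interpret H: group ?H by (rule grp)
  note HG = subgroup.mem_carrier[OF H(1)] and Hm = subgroup.m_closed[OF H(1)]
  fix A :: "nat set" and S
  assume "is_SFT G A S"
  then obtain W L where A: "finite A" and W: "finite W" "W \<subseteq> carrier G" and ne: "S \<noteq> {}"
    and S: "S = local_rule_shift G A W L"
    by (rule is_SFT_obtain_local_rule)
  obtain \<tau> where \<tau>: "\<tau> \<in> carrier G \<rightarrow> carrier G" "\<And>g. g \<in> carrier G \<Longrightarrow> g \<otimes> inv \<tau> g \<in> H"
      "\<And>h g. \<lbrakk>h \<in> H; g \<in> carrier G\<rbrakk> \<Longrightarrow> \<tau> (h \<otimes> g) = \<tau> g" "finite (\<tau> ` carrier G)"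
    using transversal[OF H(1)] H(2) by metis
  \<comment> \<open>The pair \<open>(\<eta> g, \<tau> g)\<close> gives coordinates of
    \<open>g\<close> in \<open>H\<close> and the transversal. Left multiplication by
    \<open>h\<close> in \<open>H\<close> multiplies the first by \<open>h\<close> and fixes the
    second.\<close>
  define \<eta> where "\<eta> g = g \<otimes> inv \<tau> g" for g
  define T where "T = \<tau> ` carrier G"
  have T: "finite T" "T \<subseteq> carrier G" "\<And>g. g \<in> carrier G \<Longrightarrow> \<tau> g \<in> T"
    using \<tau> by (auto simp: T_def)
  have \<tau>_carr: "\<tau> g \<in> carrier G" if "g \<in> carrier G" for g
    using T that by blast
  have \<eta>_mem: "\<eta> g \<in> H" if "g \<in> carrier G" for g
    using \<tau>(2)[OF that] by (simp add: \<eta>_def)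
  have decomp: "\<eta> g \<otimes> \<tau> g = g" if "g \<in> carrier G" for g
    using that \<tau>_carr by (simp add: \<eta>_def m_assoc)
  have \<eta>_mult: "\<eta> (h \<otimes> g) = h \<otimes> \<eta> g" if "h \<in> H" "g \<in> carrier G" for h g
    using that \<tau>(3) \<tau>_carr HG by (simp add: \<eta>_def m_assoc)

  \<comment> \<open>The rule at \<open>h \<otimes> t\<close> inspects
    \<open>h \<otimes> t \<otimes> w\<close>, whose coordinates are
    \<open>h \<otimes> \<eta> (t \<otimes> w)\<close> and \<open>\<tau> (t \<otimes> w)\<close>. The
    first coordinates determine the window over \<open>H\<close>; the second select entries of the
    letters found there.\<close>
  define V where "V = (\<lambda>(t, w). \<eta> (t \<otimes> w)) ` (T \<times> W)"
  have V: "finite V" "V \<subseteq> H" "\<And>t w. \<lbrakk>t \<in> T; w \<in> W\<rbrakk> \<Longrightarrow> \<eta> (t \<otimes> w) \<in> V"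
    using T(1,2) W \<eta>_mem by (auto simp: V_def subset_iff)
  \<comment> \<open>One test at \<open>h\<close> checks the original rule at all
    \<open>h \<otimes> t\<close> with \<open>t\<close> in \<open>T\<close>; as \<open>h\<close>
    varies, these exhaust \<open>G\<close>.\<close>
  define L' where "L' = {p. \<forall>t\<in>T. (\<lambda>w\<in>W. p (\<eta> (t \<otimes> w)) (\<tau> (t \<otimes> w))) \<in> L}"
  define Y where "Y = local_rule_shift ?H (T \<rightarrow>\<^sub>E A) V L'"
  have rule_eq: "(\<lambda>v\<in>V. y (h \<otimes> v)) \<in> L' \<longleftrightarrow>
      (\<forall>t\<in>T. (\<lambda>w\<in>W. y (h \<otimes> \<eta> (t \<otimes> w)) (\<tau> (t \<otimes> w))) \<in> L)" for y h
    unfolding L'_def using V(3) by (simp cong: restrict_cong)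

  obtain x where "x \<in> S"
    using ne by blast
  then have x: "x \<in> full_shift G A" "\<And>g. g \<in> carrier G \<Longrightarrow> (\<lambda>w\<in>W. x (g \<otimes> w)) \<in> L"
    by (auto simp: S local_rule_shift_def)
  define y0 where "y0 = (\<lambda>h\<in>H. \<lambda>t\<in>T. x (h \<otimes> t))"
  have "y0 \<in> full_shift ?H (T \<rightarrow>\<^sub>E A)"
    using x(1) T(2) HG by (auto simp: y0_def full_shift_def subset_iff)
  moreover have "(\<lambda>w\<in>W. y0 (h \<otimes> \<eta> (t \<otimes> w)) (\<tau> (t \<otimes> w))) \<in> L" if h: "h \<in> H" and t: "t \<in> T" for h t
  proof -
    have "y0 (h \<otimes> \<eta> (t \<otimes> w)) (\<tau> (t \<otimes> w)) = x ((h \<otimes> t) \<otimes> w)" if "w \<in> W" for w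
    proof -
      have carr: "t \<in> carrier G" "w \<in> carrier G" "h \<in> carrier G" "t \<otimes> w \<in> carrier G"
        using t that h T(2) W(2) HG by auto
      then have "y0 (h \<otimes> \<eta> (t \<otimes> w)) (\<tau> (t \<otimes> w)) = x ((h \<otimes> \<eta> (t \<otimes> w)) \<otimes> \<tau> (t \<otimes> w))"
        using h T(3) \<eta>_mem Hm by (simp add: y0_def)
      also have "(h \<otimes> \<eta> (t \<otimes> w)) \<otimes> \<tau> (t \<otimes> w) = h \<otimes> (\<eta> (t \<otimes> w) \<otimes> \<tau> (t \<otimes> w))"
        using carr(3) HG[OF \<eta>_mem[OF carr(4)]] \<tau>_carr[OF carr(4)] by (rule m_assoc)
      finally show ?thesis
        using carr by (simp add: decomp m_assoc)
    qed
    then have "(\<lambda>w\<in>W. y0 (h \<otimes> \<eta> (t \<otimes> w)) (\<tau> (t \<otimes> w))) = (\<lambda>w\<in>W. x ((h \<otimes> t) \<otimes> w))"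
      by (intro restrict_ext)
    then show ?thesis
      using x(2) h t HG T(2) by auto
  qed
  ultimately have "y0 \<in> Y"
    by (simp add: Y_def local_rule_shift_def rule_eq)
  then have "is_SFT ?H (T \<rightarrow>\<^sub>E A) Y"
    unfolding Y_def using A T(1) V by (intro H.is_SFT_local_rule_shift) (auto intro: finite_PiE)
  \<comment> \<open>Letters are now functions on \<open>T\<close> rather than natural numbers, hence
    the version of strong periodicity for arbitrary alphabets.\<close>
  then obtain y where "y \<in> Y" and fin: "finite_index ?H (stabilizer ?H (shift_action ?H) y)"
    using strongly_periodic_groupD[OF grp per] by (auto simp: strongly_periodic_config_def)
  then have y: "y \<in> full_shift ?H (T \<rightarrow>\<^sub>E A)"
      "\<And>h t. \<lbrakk>h \<in> H; t \<in> T\<rbrakk> \<Longrightarrow> (\<lambda>w\<in>W. y (h \<otimes> \<eta> (t \<otimes> w)) (\<tau> (t \<otimes> w))) \<in> L"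
    by (auto simp: Y_def local_rule_shift_def rule_eq)

  \<comment> \<open>This inverts the passage from \<open>x\<close> to \<open>y0\<close>: read entry
    \<open>\<tau> g\<close> of the letter at \<open>\<eta> g\<close>.\<close>
  define z where "z = (\<lambda>g\<in>carrier G. y (\<eta> g) (\<tau> g))"
  have "y (\<eta> g) (\<tau> g) \<in> A" if "g \<in> carrier G" for g
    using y(1) \<eta>_mem[OF that] T(3)[OF that] by (auto simp: full_shift_def dest!: PiE_mem)
  then have z: "z \<in> full_shift G A"
    by (simp add: z_def full_shift_def)
  have "(\<lambda>w\<in>W. z (g \<otimes> w)) \<in> L" if g: "g \<in> carrier G" for g
  proof -
    \<comment> \<open>The rule for \<open>z\<close> at \<open>g\<close> is thereby the rule for
      \<open>y\<close> with \<open>h = \<eta> g\<close> and \<open>t = \<tau> g\<close>.\<close>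
    have "z (g \<otimes> w) = y (\<eta> g \<otimes> \<eta> (\<tau> g \<otimes> w)) (\<tau> (\<tau> g \<otimes> w))" if "w \<in> W" for w
    proof -
      have w: "w \<in> carrier G"
        using that W(2) by blast
      have "g \<otimes> w = \<eta> g \<otimes> (\<tau> g \<otimes> w)"
        using decomp[OF g] g w \<tau>_carr HG[OF \<eta>_mem] by (simp add: m_assoc[symmetric])
      moreover have "\<eta> g \<in> H" "\<tau> g \<otimes> w \<in> carrier G"
        using g w \<tau>_carr \<eta>_mem by auto
      ultimately show ?thesis
        using g w \<eta>_mult \<tau>(3) HG by (simp add: z_def)
    qed
    then have "(\<lambda>w\<in>W. z (g \<otimes> w)) = (\<lambda>w\<in>W. y (\<eta> g \<otimes> \<eta> (\<tau> g \<otimes> w)) (\<tau> (\<tau> g \<otimes> w)))"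
      by (intro restrict_ext)
    then show ?thesis
      using y(2)[OF \<eta>_mem[OF g] T(3)[OF g]] by simp
  qed
  then have "z \<in> S"
    using z by (simp add: S local_rule_shift_def)
  moreover have "finite_index G (stabilizer G (shift_action G) z)"
  proof (rule finite_index_trans[OF H _ fin])
    show "subgroup (stabilizer ?H (shift_action ?H) y) ?H"
      by (rule H.stabilizer_shift_subgroup[OF y(1)])
    show "subgroup (stabilizer G (shift_action G) z) G"
      by (rule stabilizer_shift_subgroup[OF z])
    \<comment> \<open>A period of \<open>y\<close> acts only on the coordinate
      \<open>\<eta> g\<close>, where \<open>y\<close> does not notice it.\<close>
    show "stabilizer ?H (shift_action ?H) y \<subseteq> stabilizer G (shift_action G) z"
      unfolding stabilizer_shift_eq[OF z] using HG \<eta>_mem \<eta>_mult \<tau>(3)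
      by (auto simp: H.stabilizer_shift_eq[OF y(1)] z_def)
  qed
  ultimately show "\<exists>z\<in>S. strongly_periodic_config G z"
    by (auto simp: strongly_periodic_config_def)
qed

theorem theorem2:
  fixes G1 :: "('g, 'm) monoid_scheme" and G2 :: "('h, 'n) monoid_scheme"
  assumes "finitely_generated_group G1"
    and "finitely_generated_group G2"
    and "commensurable G1 G2"
    and "strongly_periodic_group G1"
  shows "strongly_periodic_group G2"
proof -
  have G1: "group G1" and G2: "group G2"
    using assms(1,2) by (auto simp: finitely_generated_group_def)
  obtain H :: "'g monoid" and K1 K2 where K1: "subgroup K1 G1" "G1\<lparr>carrier := K1\<rparr> \<cong> H"
    and K2: "subgroup K2 G2" "finite_index G2 K2" "G2\<lparr>carrier := K2\<rparr> \<cong> H"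
    using assms(3) by (auto simp: commensurable_def has_finite_index_copy_def)
  have gK1: "group (G1\<lparr>carrier := K1\<rparr>)" and gK2: "group (G2\<lparr>carrier := K2\<rparr>)"
    using K1(1) K2(1) G1 G2 by (auto intro: subgroup.subgroup_is_group)
  \<comment> \<open>Composing the two isomorphisms through \<open>H\<close> embeds \<open>K2\<close>
    into \<open>G1\<close> with image \<open>K1\<close>, which is what the descent step
    requires.\<close>
  have "G2\<lparr>carrier := K2\<rparr> \<cong> G1\<lparr>carrier := K1\<rparr>"
    using K2(3) group.iso_sym[OF gK1 K1(2)] by (rule iso_trans)
  then obtain \<phi> where \<phi>: "\<phi> \<in> iso (G2\<lparr>carrier := K2\<rparr>) (G1\<lparr>carrier := K1\<rparr>)"
    by (auto simp: is_iso_def)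
  then have "\<phi> \<in> hom (G2\<lparr>carrier := K2\<rparr>) G1" "inj_on \<phi> (carrier (G2\<lparr>carrier := K2\<rparr>))"
    using subgroup.subset[OF K1(1)] by (auto simp: iso_def hom_def bij_betw_def)
  then have "strongly_periodic_group (G2\<lparr>carrier := K2\<rparr>)"
    by (rule strongly_periodic_group_embedding[OF G1 gK2 _ _ assms(4)])
  then show ?thesis
    by (rule group.strongly_periodic_group_finite_extension[OF G2 K2(1,2)])
qed

end
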